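(* Let $q$ be a prime power and $r\geq 2$ an integer. Then $\kappa_2(Sp(2r,q))=q^{2r-1}+q^{2r-2}-q-1$. Moreover, the only disconnecting sets $S$ of this size such that every component of $Sp(2r,q)\setminus S$ has at least two vertices are the neighborhoods of hyperbolic lines, that is, the sets of the form $N(\{[u],[v],[u+x_1v],\dots,[u+x_{q-1}v]\})$, where $[u]$ and $[v]$ are adjacent vertices and $\mathbb{F}_q\setminus\{0\}=\{x_1,\dots,x_{q-1}\}$.
   Context: Let $M$ be the $2r\times 2r$ block diagonal matrix over $\mathbb{F}_q$ all of whose diagonal blocks are $\begin{bmatrix}0&-1\\1&0\end{bmatrix}$. The symplectic graph $Sp(2r,q)$ has as vertices the $1$-dimensional subspaces $[x]$ of $\mathbb{F}_q^{2r}$, where $[x]$ is the span of a non-zero column vector $x$, and $[x]\sim[y]$ if and only if $x^tMy\neq 0$. For a graph $G$ and $X\subset V(G)$, $N(X)=\{y\notin X: y\sim x\text{ for some }x\in X\}$. A disconnecting set of a connected graph $G$ is a set $S$ of vertices such that $G\setminus S$ is disconnected. $\kappa_2(G)$ denotes the minimum size of a disconnecting set $S$ of $G$ such that every component of $G\setminus S$ has at least two vertices. *)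

theory Defs
  imports
    "HOL-Library.Cardinality"
    "Graph_Theory.Digraph_Component"
    "Jordan_Normal_Form.VS_Connect"
begin

text \<open>Graphs are symmetric digraphs, as in the session Graph_Theory. For these, the strongly
  connected components (\<^const>\<open>pre_digraph.sccs\<close>) are the connected components.\<close>

definition nbhd :: "('v, 'e) pre_digraph \<Rightarrow> 'v set \<Rightarrow> 'v set" where
  "nbhd G X = {y \<in> verts G. y \<notin> X \<and> (\<exists>x\<in>X. y \<rightarrow>\<^bsub>G\<^esub> x)}"

text \<open>The null graph is not \<^const>\<open>connected\<close> in Graph_Theory; it does not count as
  disconnected either.\<close>

definition disconnected :: "('v, 'e) pre_digraph \<Rightarrow> bool" where
  "disconnected G \<longleftrightarrow> verts G \<noteq> {} \<and> \<not> connected G"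

definition disconnecting_set :: "('v, 'e) pre_digraph \<Rightarrow> 'v set \<Rightarrow> bool" where
  "disconnecting_set G S \<longleftrightarrow> S \<subseteq> verts G \<and> disconnected (G \<restriction> (verts G - S))"

definition disconnecting_set2 :: "('v, 'e) pre_digraph \<Rightarrow> 'v set \<Rightarrow> bool" where
  "disconnecting_set2 G S \<longleftrightarrow> disconnecting_set G S \<and>
     (\<forall>C \<in> pre_digraph.sccs (G \<restriction> (verts G - S)). card (verts C) \<ge> 2)"

text \<open>If there is no such set, the infimum is the junk value 0. In a finite connected graph no
  such set is empty, so there a nonzero value is an attained minimum.\<close>

definition kappa2 :: "('v, 'e) pre_digraph \<Rightarrow> nat" where
  "kappa2 G = Inf (card ` {S. disconnecting_set2 G S})"

definition symplectic_mat :: "nat \<Rightarrow> 'a::field mat" where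
  "symplectic_mat r = diag_block_mat (replicate r (mat_of_rows_list 2 [[0, -1], [1, 0]]))"

definition line :: "'a::field vec \<Rightarrow> 'a vec set" where
  "line x = {c \<cdot>\<^sub>v x | c. True}"

lemma (in vec_space) line_eq_span:
  assumes "x \<in> carrier_vec n"
  shows "line x = span {x}"
  using assms by (auto simp: line_def finite_span lincomb_def module_vec_simps M.finsum_insert)

definition symplectic_graph :: "nat \<Rightarrow> ('a::field vec set, 'a vec set \<times> 'a vec set) pre_digraph" where
  "symplectic_graph r = with_proj
     \<lparr> pverts = {line x | x. x \<in> carrier_vec (2 * r) \<and> x \<noteq> 0\<^sub>v (2 * r)},
       parcs = {(line x, line y) | x y.
         x \<in> carrier_vec (2 * r) \<and> x \<noteq> 0\<^sub>v (2 * r) \<and>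
         y \<in> carrier_vec (2 * r) \<and> y \<noteq> 0\<^sub>v (2 * r) \<and>
         x \<bullet> (symplectic_mat r *\<^sub>v y) \<noteq> 0} \<rparr>"

definition hyperbolic_line :: "'a::field vec \<Rightarrow> 'a vec \<Rightarrow> 'a vec set set" where
  "hyperbolic_line u v = {line u, line v} \<union> {line (u + c \<cdot>\<^sub>v v) | c. c \<noteq> 0}"

end

(* If S disconnects the graph, then its complement splits into parts A and B with no edges between
   them. With W = A^perp and U = W^perp, the points of A lie in U and those of B in W, and
   |U| |W| = q^(2r). Since A and B both contain an edge, U and W both contain a nondegenerate plane,
   so |U|, |W| >= q^2 and therefore |U| + |W| <= q^2 + q^(2r-2), with equality only if one of U, W is
   such a plane. In that case, if the bound for S is attained, A and B consist of all points of U and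
   of W, so one of them is a hyperbolic line and the other its perp. *)

theory Submission
  imports Defs
begin

section \<open>The symplectic form\<close>

text \<open>The condition on components is what yields the edges: in a component with two or more
  vertices every vertex has a neighbour. Without it a single point could be cut off by deleting its
  neighbours. An edge [x] ~ [y] makes x and y independent, because the form is alternating and does
  not vanish on the pair; this is where q^2 comes from. Taking U as the perp of W, and not as the
  span of A, keeps the argument to counting: the identity for |U| |W| replaces all dimension theory,
  and it turns the bound on |U| + |W| into (|U| - q^2)(|W| - q^2) \<ge> 0, with a vanishing factor
  in the case of equality. Every point carries q - 1 nonzero vectors, so the count of vectors left
  for S has to be divided by q - 1: (q^2 - 1)(q^(2r-2) - 1) / (q - 1) = (q + 1)(q^(2r-2) - 1), which
  expands to the claimed value. That the value is attained rests on nondegeneracy of the form on a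
  hyperbolic plane and on its perp: the two meet only in zero, and each point has a neighbour on its
  own side.\<close>

lemma card_ge_2_field: "2 \<le> CARD('a::{field, finite})"
  using card_mono[of UNIV "{0, 1 :: 'a}"] by simp

definition sform :: "nat \<Rightarrow> 'a::field vec \<Rightarrow> 'a vec \<Rightarrow> 'a" where
  "sform r x y = x \<bullet> (symplectic_mat r *\<^sub>v y)"

lemma symplectic_mat_carrier [simp]:
  "symplectic_mat r \<in> carrier_mat (2 * r) (2 * r)"
  by (rule carrier_matI)
    (simp_all add: symplectic_mat_def dim_diag_block_mat mat_of_rows_list_def sum_list_replicate)

lemma dim_symplectic_mat [simp]:
  "dim_row (symplectic_mat r) = 2 * r" "dim_col (symplectic_mat r) = 2 * r"
  using symplectic_mat_carrier[of r] unfolding carrier_mat_def by auto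

lemma sform_add_left:
  assumes "x \<in> carrier_vec (2 * r)" "y \<in> carrier_vec (2 * r)" "z \<in> carrier_vec (2 * r)"
  shows "sform r (x + y) z = sform r x z + sform r y z"
  using assms unfolding sform_def
  by (intro add_scalar_prod_distrib[where n = "2 * r"]) (auto intro: mult_mat_vec_carrier[OF symplectic_mat_carrier])

lemma sform_add_right:
  assumes "x \<in> carrier_vec (2 * r)" "y \<in> carrier_vec (2 * r)" "z \<in> carrier_vec (2 * r)"
  shows "sform r x (y + z) = sform r x y + sform r x z"
  using assms unfolding sform_def
  by (subst mult_add_distrib_mat_vec[OF symplectic_mat_carrier])
    (auto intro!: scalar_prod_add_distrib mult_mat_vec_carrier[OF symplectic_mat_carrier])

lemma sform_smult_left:
  assumes "x \<in> carrier_vec (2 * r)" "y \<in> carrier_vec (2 * r)"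
  shows "sform r (c \<cdot>\<^sub>v x) y = c * sform r x y"
  using assms mult_mat_vec_carrier[OF symplectic_mat_carrier] unfolding sform_def
  by (intro scalar_prod_smult_left) (simp add: carrier_vecD)

lemma sform_smult_right:
  assumes "x \<in> carrier_vec (2 * r)" "y \<in> carrier_vec (2 * r)"
  shows "sform r x (c \<cdot>\<^sub>v y) = c * sform r x y"
  using assms mult_mat_vec_carrier[OF symplectic_mat_carrier] unfolding sform_def
  by (subst mult_mat_vec[OF symplectic_mat_carrier])
    (auto intro!: scalar_prod_smult_right
      simp: carrier_vecD)

lemma zero_smult_carrier: "x \<in> carrier_vec n \<Longrightarrow> 0 \<cdot>\<^sub>v x = (0\<^sub>v n :: 'a::field vec)"
  by (intro eq_vecI) auto

lemma sform_zero_left: "y \<in> carrier_vec (2 * r) \<Longrightarrow> sform r (0\<^sub>v (2 * r)) y = 0"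
  using sform_smult_left[of "0\<^sub>v (2 * r)" r y 0]
  by (simp add: zero_smult_carrier[OF zero_carrier_vec])

lemma sform_zero_right: "x \<in> carrier_vec (2 * r) \<Longrightarrow> sform r x (0\<^sub>v (2 * r)) = 0"
  using sform_smult_right[of x r "0\<^sub>v (2 * r)" 0]
  by (simp add: zero_smult_carrier[OF zero_carrier_vec])

lemmas sform_linear = sform_add_left sform_add_right sform_smult_left sform_smult_right

text \<open>The matrix is block diagonal, so splitting off two coordinates splits off one block. The
  inductions on r for the alternating law and for nondegeneracy run on this.\<close>

lemma sform_Suc:
  fixes a b :: "'a::field vec"
  assumes "a \<in> carrier_vec 2" "b \<in> carrier_vec 2" "x \<in> carrier_vec (2 * r)" "y \<in> carrier_vec (2 * r)"
  shows "sform (Suc r) (a @\<^sub>v x) (b @\<^sub>v y) = (a $ 1 * b $ 0 - a $ 0 * b $ 1) + sform r x y"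
proof -
  define J :: "'a mat" where "J = mat_of_rows_list 2 [[0, -1], [1, 0]]"
  have J: "J \<in> carrier_mat 2 2"
    unfolding J_def by (rule carrier_matI) (simp_all add: mat_of_rows_list_def)
  have "symplectic_mat (Suc r) =
      four_block_mat J (0\<^sub>m 2 (2 * r)) (0\<^sub>m (2 * r) 2) (symplectic_mat r)"
  proof -
    have "symplectic_mat (Suc r) = four_block_mat J (0\<^sub>m (dim_row J) (dim_col (symplectic_mat r :: 'a mat)))
        (0\<^sub>m (dim_row (symplectic_mat r :: 'a mat)) (dim_col J)) (symplectic_mat r)"
      unfolding symplectic_mat_def J_def[symmetric] replicate_Suc diag_block_mat.simps Let_def ..
    then show ?thesis by (simp only: carrier_matD[OF J] dim_symplectic_mat)
  qed
  then have "sform (Suc r) (a @\<^sub>v x) (b @\<^sub>v y) =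
      (a @\<^sub>v x) \<bullet> ((J *\<^sub>v b) @\<^sub>v (symplectic_mat r *\<^sub>v y))"
    unfolding sform_def by (simp only: mult_mat_vec_split[OF J symplectic_mat_carrier assms(2,4)])
  also have "\<dots> = a \<bullet> (J *\<^sub>v b) + sform r x y"
    unfolding sform_def
    by (rule scalar_prod_append)
      (use assms J in \<open>auto intro: mult_mat_vec_carrier[OF symplectic_mat_carrier]\<close>)
  also have "a \<bullet> (J *\<^sub>v b) = a $ 1 * b $ 0 - a $ 0 * b $ 1"
  proof -
    have b: "dim_vec b = 2" using assms by simp
    have "(J *\<^sub>v b) $ 0 = - b $ 1" "(J *\<^sub>v b) $ 1 = b $ 0" "dim_vec (J *\<^sub>v b) = 2"
      using b by (simp_all add: J_def mat_of_rows_list_def scalar_prod_def numeral_2_eq_2)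
    then show ?thesis by (simp add: scalar_prod_def numeral_2_eq_2)
  qed
  finally show ?thesis .
qed

lemma carrier_vec_Suc_cases:
  assumes "x \<in> carrier_vec (2 * Suc r)"
  obtains a y where "a \<in> carrier_vec 2" "y \<in> carrier_vec (2 * r)" "x = a @\<^sub>v y"
proof -
  have "x \<in> carrier_vec (2 + 2 * r)" using assms by simp
  then show ?thesis
    using that[of "vec_first x 2" "vec_last x (2 * r)"] by (simp del: mult_Suc_right)
qed

text \<open>In characteristic 2 alternating is stronger than antisymmetric, so it is proved first,
  block by block; antisymmetry then follows by expanding the form at x + y.\<close>

lemma sform_self: "x \<in> carrier_vec (2 * r) \<Longrightarrow> sform r x x = 0"
proof (induction r arbitrary: x)
  case 0
  then show ?case by (simp add: sform_def scalar_prod_def symplectic_mat_def)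
next
  case (Suc r)
  from Suc.prems obtain a y where "a \<in> carrier_vec 2" "y \<in> carrier_vec (2 * r)" "x = a @\<^sub>v y"
    by (rule carrier_vec_Suc_cases)
  then show ?case using Suc.IH by (simp add: sform_Suc)
qed

lemma sform_swap:
  assumes x: "x \<in> carrier_vec (2 * r)" and y: "y \<in> carrier_vec (2 * r)"
  shows "sform r y x = - sform r x y"
proof -
  have "sform r (x + y) (x + y) = sform r x y + sform r y x"
    using x y by (simp add: sform_linear sform_self[OF x] sform_self[OF y])
  then show ?thesis
    using x y sform_self[of "x + y" r] by (metis add.commute add_carrier_vec eq_neg_iff_add_eq_0)
qed

text \<open>Each block pairs its coordinate 0 with its coordinate 1, so a nonzero entry in the first
  block is detected by the unit vector of the other coordinate. If that block is zero, the tail is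
  nonzero and the induction hypothesis applies.\<close>

lemma sform_nondegenerate:
  fixes x :: "'a::field vec"
  shows "x \<in> carrier_vec (2 * r) \<Longrightarrow> x \<noteq> 0\<^sub>v (2 * r) \<Longrightarrow> \<exists>y \<in> carrier_vec (2 * r). sform r x y \<noteq> 0"
proof (induction r arbitrary: x)
  case 0
  then have "x = 0\<^sub>v (2 * 0)" by (intro eq_vecI) auto
  with 0 show ?case by simp
next
  case (Suc r)
  from Suc.prems(1) obtain a y where ay: "a \<in> carrier_vec 2" "y \<in> carrier_vec (2 * r)" "x = a @\<^sub>v y"
    by (rule carrier_vec_Suc_cases)
  have carr: "b @\<^sub>v z \<in> carrier_vec (2 * Suc r)"
    if "b \<in> carrier_vec 2" "z \<in> carrier_vec (2 * r)" for b z :: "'a vec"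
    using append_carrier_vec[OF that] by simp
  have zero: "sform r w (0\<^sub>v (2 * r)) = 0" if "w \<in> carrier_vec (2 * r)" for w :: "'a vec"
    using that by (rule sform_zero_right)
  consider "a $ 0 \<noteq> 0" | "a $ 1 \<noteq> 0" | "a $ 0 = 0" "a $ 1 = 0" by blast
  then show ?case
  proof cases
    case 1
    let ?b = "unit_vec 2 1 :: 'a vec"
    have "sform (Suc r) x (?b @\<^sub>v 0\<^sub>v (2 * r)) \<noteq> 0"
      using 1 ay zero by (simp add: sform_Suc)
    then show ?thesis using carr[of ?b "0\<^sub>v (2 * r)"] by auto
  next
    case 2
    let ?b = "unit_vec 2 0 :: 'a vec"
    have "sform (Suc r) x (?b @\<^sub>v 0\<^sub>v (2 * r)) \<noteq> 0"
      using 2 ay zero by (simp add: sform_Suc)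
    then show ?thesis using carr[of ?b "0\<^sub>v (2 * r)"] by auto
  next
    case 3
    have "y \<noteq> 0\<^sub>v (2 * r)"
    proof
      assume "y = 0\<^sub>v (2 * r)"
      then have "x = 0\<^sub>v (2 * Suc r)"
        using ay 3 by (intro eq_vecI) (auto simp: less_2_cases_iff)
      then show False using Suc.prems by simp
    qed
    then obtain z where z: "z \<in> carrier_vec (2 * r)" "sform r y z \<noteq> 0"
      using Suc.IH ay by blast
    have "sform (Suc r) x (0\<^sub>v 2 @\<^sub>v z) \<noteq> 0"
      using ay z 3 by (simp add: sform_Suc)
    then show ?thesis using carr[of "0\<^sub>v 2" z] z by auto
  qed
qed

section \<open>Counting vectors in subspaces and their perps\<close>

lemma bij_betw_list_of_vec:
  "bij_betw list_of_vec (carrier_vec n) {xs. set xs \<subseteq> UNIV \<and> length xs = n}"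
  by (rule bij_betw_byWitness[where f' = vec_of_list])
    (auto simp: vec_list list_vec intro: carrier_vecI)

lemma finite_carrier_vec: "finite (carrier_vec n :: 'a::finite vec set)"
  using bij_betw_finite[OF bij_betw_list_of_vec[of n, where 'a = 'a]]
    finite_lists_length_eq[of "UNIV :: 'a set" n] by simp

lemma card_carrier_vec: "card (carrier_vec n :: 'a::finite vec set) = CARD('a) ^ n"
  using bij_betw_same_card[OF bij_betw_list_of_vec[of n, where 'a = 'a]]
    card_lists_length_eq[of "UNIV :: 'a set" n] by simp

text \<open>Subspaces are bare closed sets: dimensions enter only through cardinalities, so no bases
  are required.\<close>

definition lin_closed :: "nat \<Rightarrow> 'a::field vec set \<Rightarrow> bool" where
  "lin_closed n U \<longleftrightarrow> U \<subseteq> carrier_vec n \<and> 0\<^sub>v n \<in> U \<and> (\<forall>x\<in>U. \<forall>y\<in>U. x + y \<in> U) \<and>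
    (\<forall>x\<in>U. \<forall>c. c \<cdot>\<^sub>v x \<in> U)"

lemma lin_closed_carrier: "lin_closed n (carrier_vec n)"
  by (simp add: lin_closed_def)

text \<open>Scale w to a vector v with f v = 1. Then every x in U is uniquely a kernel element plus
  a multiple of v, the multiple being f x, so U is in bijection with the field times the
  kernel.\<close>

lemma card_functional_kernel:
  fixes f :: "'a::{field, finite} vec \<Rightarrow> 'a"
  assumes U: "lin_closed n U"
    and add: "\<And>x y. x \<in> U \<Longrightarrow> y \<in> U \<Longrightarrow> f (x + y) = f x + f y"
    and smult: "\<And>c x. x \<in> U \<Longrightarrow> f (c \<cdot>\<^sub>v x) = c * f x"
    and nz: "w \<in> U" "f w \<noteq> 0"
  shows "CARD('a) * card {x \<in> U. f x = 0} = card U"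
proof -
  define v where "v = inverse (f w) \<cdot>\<^sub>v w"
  have v: "v \<in> U" "f v = 1" "v \<in> carrier_vec n"
    using U nz by (auto simp: v_def smult lin_closed_def)
  have carr: "x \<in> U \<Longrightarrow> x \<in> carrier_vec n" for x using U by (auto simp: lin_closed_def)
  have sub: "x + c \<cdot>\<^sub>v v \<in> U" if "x \<in> U" for x c
    using U that v by (auto simp: lin_closed_def)
  have fsub: "f (x + c \<cdot>\<^sub>v v) = f x + c" if "x \<in> U" for x c
    using U that v by (simp add: add smult lin_closed_def)
  have cancel: "x + c \<cdot>\<^sub>v v + d \<cdot>\<^sub>v v = x" if "x \<in> U" "c + d = 0" for x c d
  proof -
    have "x + c \<cdot>\<^sub>v v + d \<cdot>\<^sub>v v = x + (c + d) \<cdot>\<^sub>v v"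
      using carr[OF that(1)] v
      by (simp add: assoc_add_vec[where n = n] add_smult_distrib_vec)
    then show ?thesis using that v carr by (simp add: zero_smult_carrier[OF v(3)])
  qed
  have "bij_betw (\<lambda>(c, x). x + c \<cdot>\<^sub>v v) (UNIV \<times> {x \<in> U. f x = 0}) U"
    by (rule bij_betw_byWitness[where f' = "\<lambda>x. (f x, x + (- f x) \<cdot>\<^sub>v v)"])
      (auto simp: sub fsub cancel)
  from bij_betw_same_card[OF this] show ?thesis by (simp add: card_cartesian_product)
qed

definition perp :: "nat \<Rightarrow> 'a::field vec set \<Rightarrow> 'a vec set" where
  "perp r X = {y \<in> carrier_vec (2 * r). \<forall>x\<in>X. sform r x y = 0}"

lemma lin_closed_perp: "X \<subseteq> carrier_vec (2 * r) \<Longrightarrow> lin_closed (2 * r) (perp r X)"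
  unfolding lin_closed_def perp_def
  by (auto simp: sform_linear sform_zero_right subset_iff)

lemma finite_perp: "finite (perp r (X :: 'a::{field, finite} vec set))"
  by (rule finite_subset[OF _ finite_carrier_vec]) (auto simp: perp_def)

text \<open>Count the pairs \<open>(x, y)\<close> with \<open>x \<in> U\<close> and \<open>sform r x y = 0\<close> in two ways:
  every functional that is not constantly zero vanishes on a fraction \<open>1 / q\<close> of its domain.\<close>

lemma card_perp:
  fixes U :: "'a::{field, finite} vec set"
  assumes U: "lin_closed (2 * r) U"
  shows "card U * card (perp r U) = CARD('a) ^ (2 * r)"
proof -
  let ?V = "carrier_vec (2 * r) :: 'a vec set" and ?q = "CARD('a)"
  have UV: "U \<subseteq> ?V" and U0: "0\<^sub>v (2 * r) \<in> U" using U by (auto simp: lin_closed_def)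
  have finV: "finite ?V" and finU: "finite U"
    using finite_carrier_vec finite_subset[OF UV] by blast+
  have PV: "perp r U \<subseteq> ?V" by (auto simp: perp_def)
  have left: "?q * card {x \<in> U. sform r x y = 0} = (if y \<in> perp r U then ?q * card U else card U)"
    if y: "y \<in> ?V" for y
  proof (cases "y \<in> perp r U")
    case True
    then have "{x \<in> U. sform r x y = 0} = U" by (auto simp: perp_def)
    then show ?thesis using True by simp
  next
    case False
    then obtain w where "w \<in> U" "sform r w y \<noteq> 0" using y by (auto simp: perp_def)
    then show ?thesis
      using False card_functional_kernel[OF U, of "\<lambda>x. sform r x y" w] UV y
      by (auto simp: sform_linear subset_iff)
  qed
  have right: "?q * card {y \<in> ?V. sform r x y = 0} =
      (if x = 0\<^sub>v (2 * r) then ?q * card ?V else card ?V)" if x: "x \<in> ?V" for x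
  proof (cases "x = 0\<^sub>v (2 * r)")
    case True
    then have "{y \<in> ?V. sform r x y = 0} = ?V" using sform_zero_left by auto
    then show ?thesis using True by simp
  next
    case False
    with x obtain w where "w \<in> ?V" "sform r x w \<noteq> 0" using sform_nondegenerate by blast
    then show ?thesis
      using False card_functional_kernel[OF lin_closed_carrier, where f = "\<lambda>y. sform r x y" and w = w] x
      by (auto simp: sform_linear)
  qed
  have "(\<Sum>y\<in>?V. card {x \<in> U. sform r x y = 0}) = (\<Sum>x\<in>U. card {y \<in> ?V. sform r x y = 0})"
    using sum.swap_restrict[OF finV finU, where g = "\<lambda>y x. (1 :: nat)" and R = "\<lambda>y x. sform r x y = 0"] by simp
  then have "(\<Sum>y\<in>?V. ?q * card {x \<in> U. sform r x y = 0}) =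
      (\<Sum>x\<in>U. ?q * card {y \<in> ?V. sform r x y = 0})"
    by (simp flip: sum_distrib_left)
  then have *: "(\<Sum>y\<in>?V. if y \<in> perp r U then ?q * card U else card U) =
      (\<Sum>x\<in>U. if x = 0\<^sub>v (2 * r) then ?q * card ?V else card ?V)"
    using left right UV by (simp add: subset_iff cong: sum.cong)
  \<comment> \<open>In the integers each sum splits into a uniform term and an excess with factor q
    - 1 at the exceptional vectors. The uniform part |V| |U| is common to both counts and
    cancels.\<close>
  have "int (\<Sum>y\<in>?V. if y \<in> perp r U then ?q * card U else card U) =
      (\<Sum>y\<in>?V. int (card U) + (if y \<in> perp r U then (int ?q - 1) * card U else 0))"
    unfolding of_nat_sum by (rule sum.cong) (auto simp: algebra_simps)
  also have "\<dots> = int (card ?V) * card U + (int ?q - 1) * card (perp r U) * card U"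
    using finV PV by (simp add: sum.distrib Int_absorb1 flip: sum.inter_restrict)
  finally have l: "int (\<Sum>y\<in>?V. if y \<in> perp r U then ?q * card U else card U) =
    int (card ?V) * card U + (int ?q - 1) * card (perp r U) * card U" .
  have "int (\<Sum>x\<in>U. if x = 0\<^sub>v (2 * r) then ?q * card ?V else card ?V) =
      (\<Sum>x\<in>U. int (card ?V) + (if x = 0\<^sub>v (2 * r) then (int ?q - 1) * card ?V else 0))"
    unfolding of_nat_sum by (rule sum.cong) (auto simp: algebra_simps)
  also have "\<dots> = int (card ?V) * card U + (int ?q - 1) * card ?V"
    using finU U0 by (simp add: sum.distrib)
  finally have r: "int (\<Sum>x\<in>U. if x = 0\<^sub>v (2 * r) then ?q * card ?V else card ?V) =
    int (card ?V) * card U + (int ?q - 1) * card ?V" .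
  have "(int ?q - 1) * (card (perp r U) * card U) = (int ?q - 1) * card ?V"
    using l[unfolded * r] by (simp only: of_nat_mult)
  moreover have "int ?q - 1 \<noteq> 0"
    using card_ge_2_field[where 'a = 'a] by simp
  ultimately have "int (card U * card (perp r U)) = int (card ?V)"
    by (metis mult_cancel_left mult.commute)
  then show ?thesis by (simp only: of_nat_eq_iff card_carrier_vec)
qed

section \<open>Cuts of symmetric digraphs\<close>

lemma dominates_induceI:
  assumes "u \<rightarrow>\<^bsub>G\<^esub> v" "u \<in> T" "v \<in> T"
  shows "u \<rightarrow>\<^bsub>G \<restriction> T\<^esub> v"
  using assms by (force simp: arcs_ends_conv)

text \<open>A consists of everything reachable from a vertex a that fails to reach some b; B is all
  the rest and may comprise several components. A neighbour of a lies in A by reachability, and one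
  of b lies in B by symmetry.\<close>

lemma (in sym_digraph) disconnecting_set2_split:
  assumes D: "disconnecting_set2 G S"
  obtains A B where "A \<union> B = verts G - S" "A \<inter> B = {}"
    "\<forall>a\<in>A. \<forall>b\<in>B. \<not> a \<rightarrow>\<^bsub>G\<^esub> b"
    "\<exists>a\<in>A. \<exists>a'\<in>A. a \<rightarrow>\<^bsub>G\<^esub> a'" "\<exists>b\<in>B. \<exists>b'\<in>B. b \<rightarrow>\<^bsub>G\<^esub> b'"
proof -
  let ?H = "G \<restriction> (verts G - S)"
  have "induced_subgraph ?H G" by (rule induced_induce) simp
  then interpret H: sym_digraph ?H by (rule induced_graph_imp_graph)
  \<comment> \<open>\<open>strongly_connected\<close> also demands a nonempty vertex set; as
    \<open>disconnected\<close> rules out the null graph, its failure must come from an unreachable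
    pair.\<close>
  have "verts ?H \<noteq> {}" "\<not> strongly_connected (mk_symmetric ?H)"
    using D by (auto simp: disconnecting_set2_def disconnecting_set_def disconnected_def
      connected_def)
  then obtain a b where ab: "a \<in> verts ?H" "b \<in> verts ?H" "\<not> a \<rightarrow>\<^sup>*\<^bsub>?H\<^esub> b"
    by (auto simp: strongly_connected_def H.reachable_mk_symmetric_eq[OF H.sym_arcs])
  define A where "A = {w. a \<rightarrow>\<^sup>*\<^bsub>?H\<^esub> w}"
  have AH: "A \<subseteq> verts ?H" using H.reachable_in_verts by (auto simp: A_def)
  have arc_H: "u \<rightarrow>\<^bsub>?H\<^esub> v" if "u \<rightarrow>\<^bsub>G\<^esub> v" "u \<in> verts ?H" "v \<in> verts ?H" for u v
    using that dominates_induceI by fastforce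
  \<comment> \<open>The component of u contains a second vertex, and the first arc of a walk to it
    leads from u to a neighbour.\<close>
  have neighbour: "\<exists>v. u \<rightarrow>\<^bsub>?H\<^esub> v" if u: "u \<in> verts ?H" for u
  proof -
    have "H.scc_of u \<in> verts ` H.sccs"
      using H.scc_of_in_sccs_verts[OF u] by (simp add: H.sccs_verts_conv)
    then have "2 \<le> card (H.scc_of u)"
      using D by (auto simp: disconnecting_set2_def)
    then have "\<not> H.scc_of u \<subseteq> {u}"
      using card_mono[of "{u}" "H.scc_of u"] by auto
    then obtain v where v: "u \<rightarrow>\<^sup>*\<^bsub>?H\<^esub> v" "v \<noteq> u"
      by (auto simp: H.scc_of_def)
    from v(1) show ?thesis
      by (cases rule: H.converse_reachable_cases) (use v(2) in auto)
  qed
  show ?thesis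
  proof
    show "A \<union> (verts ?H - A) = verts G - S" using AH by auto
    show "A \<inter> (verts ?H - A) = {}" by auto
    show no_arc: "\<forall>u\<in>A. \<forall>v\<in>verts ?H - A. \<not> u \<rightarrow>\<^bsub>G\<^esub> v"
    proof (intro ballI notI)
      fix u v assume *: "u \<in> A" "v \<in> verts ?H - A" "u \<rightarrow>\<^bsub>G\<^esub> v"
      then have "u \<rightarrow>\<^bsub>?H\<^esub> v" using arc_H AH by blast
      then show False using * H.reachable_adj_trans by (auto simp: A_def)
    qed
    have "a \<in> A" using ab by (simp add: A_def)
    moreover obtain a' where a': "a \<rightarrow>\<^bsub>?H\<^esub> a'" using neighbour[OF ab(1)] by blast
    moreover have "a' \<in> A" unfolding A_def using H.reachable_adjI[OF a'] by simp
    ultimately show "\<exists>a\<in>A. \<exists>a'\<in>A. a \<rightarrow>\<^bsub>G\<^esub> a'"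
      using dominates_induce_subgraphD[OF a'] by blast
    have "b \<in> verts ?H - A" using ab by (simp add: A_def)
    moreover obtain b' where b': "b \<rightarrow>\<^bsub>?H\<^esub> b'" using neighbour[OF ab(2)] by blast
    moreover have "b' \<notin> A"
    proof
      assume "b' \<in> A"
      moreover have "b' \<rightarrow>\<^bsub>G\<^esub> b"
        by (rule arcs_ends_symmetric[OF sym_arcs dominates_induce_subgraphD[OF b']])
      ultimately show False using no_arc \<open>b \<in> verts ?H - A\<close> by blast
    qed
    ultimately show "\<exists>b\<in>verts ?H - A. \<exists>b'\<in>verts ?H - A. b \<rightarrow>\<^bsub>G\<^esub> b'"
      using dominates_induce_subgraphD[OF b'] H.adj_in_verts(2)[OF b'] by blast
  qed
qed

text \<open>The components need not be determined: a walk that starts in A never leaves A, and any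
  vertex of a component brings its neighbour into the same component. The neighbour has to be a
  different vertex, since a loop would not give a second one.\<close>

lemma (in sym_digraph) disconnecting_set2I:
  assumes fin: "finite (verts G)" and S: "S \<subseteq> verts G"
    and AB: "A \<union> B = verts G - S" "A \<inter> B = {}" "A \<noteq> {}" "B \<noteq> {}"
    and no_arc: "\<And>a b. a \<in> A \<Longrightarrow> b \<in> B \<Longrightarrow> \<not> a \<rightarrow>\<^bsub>G\<^esub> b"
    and neighbour: "\<And>x. x \<in> A \<union> B \<Longrightarrow> \<exists>y\<in>A \<union> B. y \<noteq> x \<and> x \<rightarrow>\<^bsub>G\<^esub> y"
  shows "disconnecting_set2 G S"
proof -
  let ?H = "G \<restriction> (verts G - S)"
  have "induced_subgraph ?H G" by (rule induced_induce) simp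
  then interpret H: sym_digraph ?H by (rule induced_graph_imp_graph)
  have in_A: "w \<in> A" if "v \<rightarrow>\<^sup>*\<^bsub>?H\<^esub> w" "v \<in> A" for v w
    using that
  proof (induction rule: H.reachable_induct)
    case (step x y)
    then have "x \<in> A" "x \<rightarrow>\<^bsub>G\<^esub> y" "y \<in> A \<union> B"
      using AB(1) H.adj_in_verts dominates_induce_subgraphD by auto
    then show ?case using no_arc by blast
  qed
  have "\<not> connected ?H"
  proof
    assume "connected ?H"
    then have "strongly_connected ?H"
      using H.symmetric_connected_imp_strongly_connected H.sym_arcs by blast
    moreover obtain a b where "a \<in> A" "b \<in> B" using AB by blast
    moreover have "a \<in> verts ?H" "b \<in> verts ?H" using AB(1) \<open>a \<in> A\<close> \<open>b \<in> B\<close> by auto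
    ultimately have "a \<rightarrow>\<^sup>*\<^bsub>?H\<^esub> b" by (auto simp: strongly_connected_def)
    then show False using in_A \<open>a \<in> A\<close> \<open>b \<in> B\<close> AB(2) by blast
  qed
  moreover have "verts ?H \<noteq> {}" using AB by auto
  moreover have "2 \<le> card (verts C)" if "C \<in> H.sccs" for C
  proof -
    have C: "verts C \<in> H.sccs_verts" using that by (auto simp: H.sccs_verts_conv)
    then obtain x where x: "x \<in> verts C" by (auto simp: H.in_sccs_verts_conv_reachable)
    then have "x \<in> A \<union> B" using H.sccs_verts_subsets[OF C] AB(1) by auto
    then obtain y where y: "y \<in> A \<union> B" "y \<noteq> x" "x \<rightarrow>\<^bsub>G\<^esub> y" using neighbour by blast
    then have "x \<rightarrow>\<^bsub>?H\<^esub> y"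
      using \<open>x \<in> A \<union> B\<close> AB(1) by (simp add: dominates_induceI)
    then have "x \<rightarrow>\<^sup>*\<^bsub>?H\<^esub> y" "y \<rightarrow>\<^sup>*\<^bsub>?H\<^esub> x"
      using H.symmetric_reachable' by blast+
    then have "{x, y} \<subseteq> verts C"
      using C x unfolding H.in_sccs_verts_conv_reachable by blast
    moreover have "finite (verts C)"
      using H.sccs_verts_subsets[OF C] fin by (auto intro: finite_subset)
    ultimately show ?thesis using card_mono[of "verts C" "{x, y}"] y(2) by simp
  qed
  ultimately show ?thesis
    using S by (auto simp: disconnecting_set2_def disconnecting_set_def disconnected_def)
qed

section \<open>Points of the symplectic graph\<close>

lemma self_in_line: "x \<in> line x"
  unfolding line_def by (auto intro!: exI[of _ 1])

lemma line_smult: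
  assumes "c \<noteq> 0"
  shows "line (c \<cdot>\<^sub>v x) = line (x :: 'a::field vec)"
proof -
  have "d \<cdot>\<^sub>v x \<in> line (c \<cdot>\<^sub>v x)" for d
    unfolding line_def using assms by (auto simp: smult_smult_assoc intro!: exI[of _ "d / c"])
  then show ?thesis by (auto simp: line_def smult_smult_assoc)
qed

lemma line_eqD:
  assumes "line y = line x" "x \<in> carrier_vec n" "y \<noteq> 0\<^sub>v n"
  obtains c where "c \<noteq> 0" "y = c \<cdot>\<^sub>v x"
proof -
  obtain c where "y = c \<cdot>\<^sub>v x" using self_in_line[of y] assms(1) by (auto simp: line_def)
  moreover from this have "c \<noteq> 0" using assms(2,3) zero_smult_carrier[of x n] by auto
  ultimately show ?thesis using that by blast
qed

lemma smult_eq_zero_iff: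
  fixes c :: "'a::field"
  assumes "x \<in> carrier_vec n"
  shows "c \<cdot>\<^sub>v x = 0\<^sub>v n \<longleftrightarrow> c = 0 \<or> x = 0\<^sub>v n"
proof
  assume *: "c \<cdot>\<^sub>v x = 0\<^sub>v n"
  show "c = 0 \<or> x = 0\<^sub>v n"
  proof (rule disjCI)
    assume "x \<noteq> 0\<^sub>v n"
    then obtain i where "i < n" "x $ i \<noteq> 0" using assms by (auto simp: vec_eq_iff)
    moreover have "(c \<cdot>\<^sub>v x) $ i = 0" using * \<open>i < n\<close> by simp
    ultimately show "c = 0" using assms by simp
  qed
qed (use assms zero_smult_carrier in auto)

lemma verts_symplectic_graph:
  "verts (symplectic_graph r) = line ` (carrier_vec (2 * r) - {0\<^sub>v (2 * r)})"
  by (auto simp: symplectic_graph_def)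

lemma line_in_verts:
  "x \<in> carrier_vec (2 * r) \<Longrightarrow> x \<noteq> 0\<^sub>v (2 * r) \<Longrightarrow> line x \<in> verts (symplectic_graph r)"
  by (simp add: verts_symplectic_graph)

lemma vertE:
  assumes "p \<in> verts (symplectic_graph r)"
  obtains x where "x \<in> carrier_vec (2 * r)" "x \<noteq> 0\<^sub>v (2 * r)" "p = line x"
  using assms by (auto simp: verts_symplectic_graph)

lemma arcs_ends_symplectic_graph:
  "arcs_ends (symplectic_graph r) = {(line x, line y) | x y.
     x \<in> carrier_vec (2 * r) \<and> x \<noteq> 0\<^sub>v (2 * r) \<and>
     y \<in> carrier_vec (2 * r) \<and> y \<noteq> 0\<^sub>v (2 * r) \<and> sform r x y \<noteq> 0}"
  by (simp add: symplectic_graph_def sform_def)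

text \<open>Arcs are defined through some choice of representatives; another choice multiplies the
  form by nonzero scalars, so whether it vanishes depends on the points alone.\<close>

lemma dominates_symplectic_graph_iff:
  assumes x: "x \<in> carrier_vec (2 * r)" "x \<noteq> 0\<^sub>v (2 * r)"
    and y: "y \<in> carrier_vec (2 * r)" "y \<noteq> 0\<^sub>v (2 * r)"
  shows "line x \<rightarrow>\<^bsub>symplectic_graph r\<^esub> line y \<longleftrightarrow> sform r x y \<noteq> 0"
proof
  assume "line x \<rightarrow>\<^bsub>symplectic_graph r\<^esub> line y"
  then obtain x' y' where *: "line x = line x'" "line y = line y'"
    "x' \<in> carrier_vec (2 * r)" "y' \<in> carrier_vec (2 * r)" "sform r x' y' \<noteq> 0"
    by (auto simp: arcs_ends_symplectic_graph)
  obtain c where "c \<noteq> 0" "x = c \<cdot>\<^sub>v x'" using line_eqD[OF *(1) *(3) x(2)] .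
  moreover obtain d where "d \<noteq> 0" "y = d \<cdot>\<^sub>v y'" using line_eqD[OF *(2) *(4) y(2)] .
  ultimately show "sform r x y \<noteq> 0" using * by (simp add: sform_linear)
next
  assume "sform r x y \<noteq> 0"
  with x y show "line x \<rightarrow>\<^bsub>symplectic_graph r\<^esub> line y"
    unfolding arcs_ends_symplectic_graph by blast
qed

lemma sym_digraph_symplectic_graph: "sym_digraph (symplectic_graph r)"
proof (rule wf_digraph.sym_digraphI)
  show "wf_digraph (symplectic_graph r)"
    by (rule wf_digraph.intro) (auto simp: symplectic_graph_def)
  show "symmetric (symplectic_graph r)"
    unfolding symmetric_def
  proof (rule symI)
    fix a b assume "a \<rightarrow>\<^bsub>symplectic_graph r\<^esub> b"
    then obtain x y where *: "a = line x" "b = line y"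
      "x \<in> carrier_vec (2 * r)" "x \<noteq> 0\<^sub>v (2 * r)" "y \<in> carrier_vec (2 * r)" "y \<noteq> 0\<^sub>v (2 * r)"
      "sform r x y \<noteq> 0"
      by (auto simp: arcs_ends_symplectic_graph)
    have "sform r y x \<noteq> 0" using * sform_swap[OF *(3,5)] by simp
    with * show "b \<rightarrow>\<^bsub>symplectic_graph r\<^esub> a"
      by (simp add: dominates_symplectic_graph_iff)
  qed
qed

lemma finite_verts_symplectic_graph:
  "finite (verts (symplectic_graph r :: ('a::{field, finite} vec set, _) pre_digraph))"
  by (simp add: verts_symplectic_graph finite_carrier_vec)

text \<open>For a set of vertices this is the union of its points without zero. Vectors rather than
  points are counted throughout, because orthogonality then speaks of subspaces, whose sizes are
  governed by \<open>card_perp\<close>.\<close>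

definition vecs_on :: "nat \<Rightarrow> 'a::field vec set set \<Rightarrow> 'a vec set" where
  "vecs_on r A = {x \<in> carrier_vec (2 * r). x \<noteq> 0\<^sub>v (2 * r) \<and> line x \<in> A}"

lemma finite_vecs_on: "finite (vecs_on r (A :: 'a::{field, finite} vec set set))"
  by (rule finite_subset[OF _ finite_carrier_vec]) (auto simp: vecs_on_def)

lemma line_image_vecs_on:
  assumes "A \<subseteq> verts (symplectic_graph r)"
  shows "line ` vecs_on r A = A"
  using assms by (auto simp: vecs_on_def verts_symplectic_graph)

text \<open>The fibre of \<open>line\<close> over [x] consists of the q - 1 nonzero multiples of x,
  which are distinct because x has a nonzero coordinate.\<close>

lemma card_vecs_on:
  fixes A :: "'a::{field, finite} vec set set"
  assumes A: "A \<subseteq> verts (symplectic_graph r)"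
  shows "card (vecs_on r A) = (CARD('a) - 1) * card A"
proof -
  have fibre: "card {y \<in> vecs_on r A. line y = p} = CARD('a) - 1" if p: "p \<in> A" for p
  proof -
    obtain x where x: "x \<in> carrier_vec (2 * r)" "x \<noteq> 0\<^sub>v (2 * r)" "p = line x"
      using vertE[OF subsetD[OF A p]] .
    have "{y \<in> vecs_on r A. line y = p} = (\<lambda>c. c \<cdot>\<^sub>v x) ` (UNIV - {0})"
    proof (intro equalityI subsetI)
      fix y assume "y \<in> {y \<in> vecs_on r A. line y = p}"
      then have "line y = line x" "y \<noteq> 0\<^sub>v (2 * r)" using x by (auto simp: vecs_on_def)
      from line_eqD[OF this(1) x(1) this(2)] obtain c where "c \<noteq> 0" "y = c \<cdot>\<^sub>v x" .
      then show "y \<in> (\<lambda>c. c \<cdot>\<^sub>v x) ` (UNIV - {0})" by simp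
    next
      fix y assume "y \<in> (\<lambda>c. c \<cdot>\<^sub>v x) ` (UNIV - {0})"
      then obtain c where "c \<noteq> 0" "y = c \<cdot>\<^sub>v x" by auto
      then show "y \<in> {y \<in> vecs_on r A. line y = p}"
        using x that by (simp add: vecs_on_def line_smult smult_eq_zero_iff)
    qed
    moreover have "inj_on (\<lambda>c. c \<cdot>\<^sub>v x) (UNIV - {0})"
    proof (rule inj_onI)
      fix c d :: 'a assume "c \<cdot>\<^sub>v x = d \<cdot>\<^sub>v x"
      then have eq: "(c \<cdot>\<^sub>v x) $ i = (d \<cdot>\<^sub>v x) $ i" for i by (rule arg_cong)
      obtain i where i: "i < 2 * r" "x $ i \<noteq> 0" using x by (auto simp: vec_eq_iff)
      have "i < dim_vec x" using x i by auto
      then have "c * x $ i = d * x $ i" using eq[of i] by (simp only: index_smult_vec)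
      then show "c = d" using i(2) by (simp only: mult_cancel_right) blast
    qed
    ultimately show ?thesis by (simp add: card_image card_Diff_singleton)
  qed
  have "card (vecs_on r A) = (\<Sum>p\<in>A. card {y \<in> vecs_on r A. line y = p})"
    using sum.image_gen[OF finite_vecs_on, of "\<lambda>_. 1 :: nat" r A line]
    by (simp add: line_image_vecs_on[OF A])
  then show ?thesis using fibre by simp
qed

section \<open>Planes and hyperbolic lines\<close>

definition plane :: "'a::field vec \<Rightarrow> 'a vec \<Rightarrow> 'a vec set" where
  "plane u v = {a \<cdot>\<^sub>v u + b \<cdot>\<^sub>v v | a b. True}"

text \<open>Pairing with v and with u recovers the two coefficients, so the nonzero value of the
  form does the work of linear independence.\<close>

lemma card_plane:
  fixes u v :: "'a::{field, finite} vec"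
  assumes uv: "u \<in> carrier_vec (2 * r)" "v \<in> carrier_vec (2 * r)" "sform r u v \<noteq> 0"
  shows "card (plane u v) = CARD('a) ^ 2"
proof -
  have "inj (\<lambda>(a, b). a \<cdot>\<^sub>v u + b \<cdot>\<^sub>v v)"
  proof (rule injI, clarify)
    fix a b c d :: 'a
    assume *: "a \<cdot>\<^sub>v u + b \<cdot>\<^sub>v v = c \<cdot>\<^sub>v u + d \<cdot>\<^sub>v v"
    have "sform r (a \<cdot>\<^sub>v u + b \<cdot>\<^sub>v v) v = a * sform r u v" for a b
      using uv by (simp add: sform_linear sform_self)
    moreover have "sform r u (a \<cdot>\<^sub>v u + b \<cdot>\<^sub>v v) = b * sform r u v" for a b
      using uv by (simp add: sform_linear sform_self)
    ultimately have "a * sform r u v = c * sform r u v" "b * sform r u v = d * sform r u v"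
      using * by metis+
    then show "a = c \<and> b = d" using uv by simp
  qed
  moreover have "plane u v = range (\<lambda>(a, b). a \<cdot>\<^sub>v u + b \<cdot>\<^sub>v v)"
    by (auto simp: plane_def)
  ultimately show ?thesis
    by (simp add: card_image card_cartesian_product power2_eq_square flip: UNIV_Times_UNIV)
qed

lemma lin_closed_plane:
  assumes "u \<in> carrier_vec n" "v \<in> carrier_vec n"
  shows "lin_closed n (plane u v)"
proof -
  have "(a \<cdot>\<^sub>v u + b \<cdot>\<^sub>v v) + (c \<cdot>\<^sub>v u + d \<cdot>\<^sub>v v) = (a + c) \<cdot>\<^sub>v u + (b + d) \<cdot>\<^sub>v v" for a b c d
    using assms by (intro eq_vecI) (auto simp: algebra_simps)
  moreover have "c \<cdot>\<^sub>v (a \<cdot>\<^sub>v u + b \<cdot>\<^sub>v v) = (c * a) \<cdot>\<^sub>v u + (c * b) \<cdot>\<^sub>v v" for a b c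
    using assms by (intro eq_vecI) (auto simp: algebra_simps)
  moreover have "0\<^sub>v n = 0 \<cdot>\<^sub>v u + 0 \<cdot>\<^sub>v v"
    using assms by (intro eq_vecI) auto
  ultimately show ?thesis
    using assms unfolding lin_closed_def plane_def by (auto, blast+)
qed

lemma plane_least:
  "lin_closed n U \<Longrightarrow> u \<in> U \<Longrightarrow> v \<in> U \<Longrightarrow> plane u v \<subseteq> U"
  by (auto simp: lin_closed_def plane_def)

text \<open>Scaling the first nonzero coefficient of a u + b v to 1 leaves v or u + (b / a) v. From
  here on the parametrised hyperbolic line is handled as a subspace.\<close>

lemma vecs_on_hyperbolic_line:
  fixes u v :: "'a::field vec"
  assumes u: "u \<in> carrier_vec (2 * r)" "u \<noteq> 0\<^sub>v (2 * r)"
    and v: "v \<in> carrier_vec (2 * r)" "v \<noteq> 0\<^sub>v (2 * r)"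
  shows "vecs_on r (hyperbolic_line u v) = plane u v - {0\<^sub>v (2 * r)}"
proof (intro equalityI subsetI)
  have closed: "lin_closed (2 * r) (plane u v)" using u v by (intro lin_closed_plane)
  have gen: "a \<cdot>\<^sub>v u + b \<cdot>\<^sub>v v \<in> plane u v" for a b by (auto simp: plane_def)
  fix x assume x: "x \<in> vecs_on r (hyperbolic_line u v)"
  then obtain y where y: "line x = line y" "y \<in> plane u v"
  proof -
    have "line x \<in> hyperbolic_line u v" using x by (simp add: vecs_on_def)
    moreover have "u \<in> plane u v" "v \<in> plane u v" "u + c \<cdot>\<^sub>v v \<in> plane u v" for c
      using gen[of 1 0] gen[of 0 1] gen[of 1 c] u v
      by (simp_all add: zero_smult_carrier[of u "2 * r"] zero_smult_carrier[of v "2 * r"])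
    ultimately show ?thesis using that by (auto simp: hyperbolic_line_def)
  qed
  then obtain c where "x = c \<cdot>\<^sub>v y"
    using self_in_line[of x] by (auto simp: line_def)
  then show "x \<in> plane u v - {0\<^sub>v (2 * r)}"
    using y closed x by (auto simp: vecs_on_def lin_closed_def)
next
  fix x assume x: "x \<in> plane u v - {0\<^sub>v (2 * r)}"
  then obtain a b where ab: "x = a \<cdot>\<^sub>v u + b \<cdot>\<^sub>v v" by (auto simp: plane_def)
  have xc: "x \<in> carrier_vec (2 * r)" using ab u v by simp
  consider "a = 0" | "a \<noteq> 0" "b = 0" | "a \<noteq> 0" "b \<noteq> 0" by blast
  then have "line x \<in> hyperbolic_line u v"
  proof cases
    case 1
    then have "x = b \<cdot>\<^sub>v v" using ab u v by (simp add: zero_smult_carrier[of u "2 * r"])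
    moreover from this have "b \<noteq> 0" using x v by (auto simp: smult_eq_zero_iff)
    ultimately show ?thesis by (simp add: line_smult hyperbolic_line_def)
  next
    case 2
    then have "x = a \<cdot>\<^sub>v u" using ab u v by (simp add: zero_smult_carrier[of v "2 * r"])
    with 2 show ?thesis by (simp add: line_smult hyperbolic_line_def)
  next
    case 3
    have "x = a \<cdot>\<^sub>v (u + (b / a) \<cdot>\<^sub>v v)"
      using 3 ab u v by (simp add: smult_add_distrib_vec[of _ "2 * r"] smult_smult_assoc)
    with 3 show ?thesis by (auto simp: line_smult hyperbolic_line_def)
  qed
  then show "x \<in> vecs_on r (hyperbolic_line u v)" using x xc by (simp add: vecs_on_def)
qed

section \<open>Neighbourhoods of hyperbolic lines\<close>

text \<open>The definition of \<open>perp\<close> puts the given set into the left argument, so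
  taking it twice exchanges the arguments and antisymmetry is called for.\<close>

lemma perp_perp_subset: "X \<subseteq> carrier_vec (2 * r) \<Longrightarrow> X \<subseteq> perp r (perp r X)"
proof
  fix x assume "X \<subseteq> carrier_vec (2 * r)" "x \<in> X"
  then have x: "x \<in> carrier_vec (2 * r)" by blast
  have "sform r y x = 0" if "y \<in> perp r X" for y
    using that \<open>x \<in> X\<close> sform_swap[OF x, of y] by (simp add: perp_def)
  then show "x \<in> perp r (perp r X)" using x by (simp add: perp_def)
qed

lemma perp_Diff_zero: "perp r (X - {0\<^sub>v (2 * r)}) = perp r X"
  by (auto simp: perp_def sform_zero_left)

lemma perp_plane:
  assumes "u \<in> carrier_vec (2 * r)" "v \<in> carrier_vec (2 * r)"
  shows "perp r (plane u v) = {y \<in> carrier_vec (2 * r). sform r u y = 0 \<and> sform r v y = 0}"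
proof -
  have "u = 1 \<cdot>\<^sub>v u + 0 \<cdot>\<^sub>v v" "v = 0 \<cdot>\<^sub>v u + 1 \<cdot>\<^sub>v v"
    using assms by (auto simp: zero_smult_carrier[of u "2 * r"] zero_smult_carrier[of v "2 * r"])
  then have "u \<in> plane u v" "v \<in> plane u v" unfolding plane_def by blast+
  then show ?thesis
    using assms by (auto simp: perp_def plane_def sform_linear)
qed

text \<open>Up to sign and the factor \<open>sform r u v\<close>, pairing with u and v reads off the
  coefficients of x. This serves twice: the plane shares no point with its perp, and every point of
  the plane has [u] or [v] as a neighbour.\<close>

lemma plane_nondegenerate:
  assumes uv: "u \<in> carrier_vec (2 * r)" "v \<in> carrier_vec (2 * r)" "sform r u v \<noteq> 0"
    and x: "x \<in> plane u v" "x \<noteq> 0\<^sub>v (2 * r)"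
  shows "sform r u x \<noteq> 0 \<or> sform r v x \<noteq> 0"
proof (rule ccontr)
  assume *: "\<not> ?thesis"
  obtain a b where ab: "x = a \<cdot>\<^sub>v u + b \<cdot>\<^sub>v v" using x by (auto simp: plane_def)
  have "sform r u x = b * sform r u v" "sform r v x = - (a * sform r u v)"
    using uv by (simp_all add: ab sform_linear sform_self sform_swap[OF uv(1,2)])
  then have "a = 0" "b = 0" using * uv by auto
  then show False
    using x uv by (simp add: ab zero_smult_carrier[of u "2 * r"] zero_smult_carrier[of v "2 * r"])
qed

text \<open>Some w pairs nontrivially with x. Projecting w along the plane into the perp does not
  change its value against x, because x is orthogonal to the plane.\<close>

lemma perp_plane_nondegenerate:
  assumes uv: "u \<in> carrier_vec (2 * r)" "v \<in> carrier_vec (2 * r)" "sform r u v \<noteq> 0"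
    and x: "x \<in> perp r (plane u v)" "x \<noteq> 0\<^sub>v (2 * r)"
  obtains y where "y \<in> perp r (plane u v)" "sform r x y \<noteq> 0"
proof -
  have xc: "x \<in> carrier_vec (2 * r)" "sform r u x = 0" "sform r v x = 0"
    using x by (simp_all add: perp_plane[OF uv(1,2)])
  obtain w where w: "w \<in> carrier_vec (2 * r)" "sform r x w \<noteq> 0"
    using sform_nondegenerate xc(1) x(2) by blast
  \<comment> \<open>The coefficients solve \<open>sform r u y = 0\<close> and
    \<open>sform r v y = 0\<close>: u and v are each orthogonal to themselves, so each equation
    determines one coefficient.\<close>
  define y where
    "y = w + ((sform r v w / sform r u v) \<cdot>\<^sub>v u + (- sform r u w / sform r u v) \<cdot>\<^sub>v v)"
  have "y \<in> carrier_vec (2 * r)" using uv w by (simp add: y_def)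
  moreover have "sform r u y = 0" "sform r v y = 0"
    using uv w by (simp_all add: y_def sform_linear sform_self sform_swap[OF uv(1,2)])
  moreover have "sform r x y = sform r x w"
    using uv w xc
    by (simp add: y_def sform_linear sform_swap[OF uv(1) xc(1)] sform_swap[OF uv(2) xc(1)])
  ultimately show ?thesis using that w by (simp add: perp_plane[OF uv(1,2)])
qed

section \<open>Neighbourhoods in terms of perps\<close>

definition perp_points :: "nat \<Rightarrow> 'a::field vec set set \<Rightarrow> 'a vec set set" where
  "perp_points r A = line ` (perp r (vecs_on r A) - {0\<^sub>v (2 * r)})"

lemma perp_points_subset: "perp_points r A \<subseteq> verts (symplectic_graph r)"
  by (auto simp: perp_points_def perp_def verts_symplectic_graph)

lemma vecs_on_line_image:
  assumes "lin_closed (2 * r) U"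
  shows "vecs_on r (line ` (U - {0\<^sub>v (2 * r)})) = U - {0\<^sub>v (2 * r)}"
proof (intro equalityI subsetI)
  fix x assume x: "x \<in> vecs_on r (line ` (U - {0\<^sub>v (2 * r)}))"
  then obtain y where y: "line x = line y" "y \<in> U" by (auto simp: vecs_on_def)
  then obtain c where "x = c \<cdot>\<^sub>v y" using self_in_line[of x] by (auto simp: line_def)
  then show "x \<in> U - {0\<^sub>v (2 * r)}" using x y assms by (auto simp: vecs_on_def lin_closed_def)
qed (use assms in \<open>auto simp: vecs_on_def lin_closed_def\<close>)

lemma vecs_on_subset_carrier: "vecs_on r A \<subseteq> carrier_vec (2 * r)"
  by (auto simp: vecs_on_def)

lemma vecs_on_perp_points:
  "vecs_on r (perp_points r A) = perp r (vecs_on r A) - {0\<^sub>v (2 * r)}"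
  unfolding perp_points_def
  by (intro vecs_on_line_image lin_closed_perp vecs_on_subset_carrier)

text \<open>A vertex lacks a neighbour in A exactly when its vectors are orthogonal to all vectors
  on A, that is, when it is a point of the perp.\<close>

lemma nbhd_symplectic_graph:
  assumes A: "A \<subseteq> verts (symplectic_graph r)"
  shows "nbhd (symplectic_graph r) A = verts (symplectic_graph r) - A - perp_points r A"
proof -
  have "(\<exists>p\<in>A. line y \<rightarrow>\<^bsub>symplectic_graph r\<^esub> p) \<longleftrightarrow> line y \<notin> perp_points r A"
    if y: "y \<in> carrier_vec (2 * r)" "y \<noteq> 0\<^sub>v (2 * r)" for y
  proof -
    have "(\<exists>p\<in>A. line y \<rightarrow>\<^bsub>symplectic_graph r\<^esub> p) \<longleftrightarrow>
        (\<exists>x\<in>vecs_on r A. line y \<rightarrow>\<^bsub>symplectic_graph r\<^esub> line x)"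
      by (subst (1) line_image_vecs_on[OF A, symmetric]) blast
    also have "\<dots> \<longleftrightarrow> (\<exists>x\<in>vecs_on r A. sform r x y \<noteq> 0)"
      using y sform_swap[OF y(1)]
      by (intro bex_cong refl) (auto simp: vecs_on_def dominates_symplectic_graph_iff)
    also have "\<dots> \<longleftrightarrow> y \<notin> vecs_on r (perp_points r A)"
      unfolding vecs_on_perp_points using y by (auto simp: perp_def)
    finally show ?thesis using y by (simp add: vecs_on_def)
  qed
  then show ?thesis by (auto simp: nbhd_def verts_symplectic_graph)
qed

lemma hyperbolic_line_subset:
  assumes "u \<in> carrier_vec (2 * r)" "u \<noteq> 0\<^sub>v (2 * r)"
    and "v \<in> carrier_vec (2 * r)" "v \<noteq> 0\<^sub>v (2 * r)" "sform r u v \<noteq> 0"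
  shows "hyperbolic_line u v \<subseteq> verts (symplectic_graph r)"
proof -
  have "u + c \<cdot>\<^sub>v v \<noteq> 0\<^sub>v (2 * r)" for c
  proof
    assume "u + c \<cdot>\<^sub>v v = 0\<^sub>v (2 * r)"
    moreover have "sform r (u + c \<cdot>\<^sub>v v) v = sform r u v"
      using assms by (simp add: sform_linear sform_self)
    ultimately show False using assms by (simp add: sform_zero_left)
  qed
  then show ?thesis using assms by (auto simp: hyperbolic_line_def intro!: line_in_verts)
qed

text \<open>The vectors on S, A and B together with zero, the final 1, exhaust the space. Only S is
  left in points, at q - 1 vectors each; the additive form keeps these sizes clear of truncated
  subtraction.\<close>

lemma card_cut:
  fixes S :: "'a::{field, finite} vec set set"
  assumes "A \<union> B = verts (symplectic_graph r) - S" "A \<inter> B = {}" "S \<subseteq> verts (symplectic_graph r)"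
  shows "(CARD('a) - 1) * card S + card (vecs_on r A) + card (vecs_on r B) + 1 = CARD('a) ^ (2 * r)"
proof -
  let ?V = "verts (symplectic_graph r) :: 'a vec set set"
  have "vecs_on r ?V = carrier_vec (2 * r) - {0\<^sub>v (2 * r)}"
    by (auto simp: vecs_on_def verts_symplectic_graph)
  then have "card (vecs_on r ?V) + 1 = CARD('a) ^ (2 * r)"
    by (simp add: card_carrier_vec finite_carrier_vec card_Diff_singleton)
  moreover have "?V = S \<union> A \<union> B" using assms by blast
  moreover have "card (S \<union> A \<union> B) = card S + card A + card B"
  proof -
    have "finite (S \<union> A \<union> B)"
      using \<open>?V = S \<union> A \<union> B\<close> finite_verts_symplectic_graph[of r, where 'a = 'a] by simp
    moreover have "S \<inter> A = {}" "(S \<union> A) \<inter> B = {}" using assms by blast+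
    ultimately show ?thesis by (simp add: card_Un_disjoint)
  qed
  moreover have "card (vecs_on r X) = (CARD('a) - 1) * card X" if "X \<subseteq> ?V" for X
    using that by (rule card_vecs_on)
  moreover have "A \<subseteq> ?V" "B \<subseteq> ?V" using assms by blast+
  ultimately show ?thesis by (simp add: distrib_left)
qed

text \<open>All powers are reduced to q^(2r-2), which the later arithmetic treats as one unknown.
  The semiring is general because both natural numbers and integers occur.\<close>

lemma power_double_split:
  assumes "r \<ge> 2"
  shows "(q :: 'a::comm_semiring_1) ^ (2 * r) = q\<^sup>2 * q ^ (2 * r - 2)"
    "q ^ (2 * r - 1) = q * q ^ (2 * r - 2)"
proof -
  have "2 * r = 2 + (2 * r - 2)" using assms by simp
  then show "q ^ (2 * r) = q\<^sup>2 * q ^ (2 * r - 2)" by (metis power_add)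
  have "2 * r - 1 = Suc (2 * r - 2)" using assms by simp
  then show "q ^ (2 * r - 1) = q * q ^ (2 * r - 2)" by (simp only: power_Suc)
qed

section \<open>The cut around one hyperbolic line\<close>

context
  fixes r :: nat and G :: "('a::{field, finite} vec set, 'a vec set \<times> 'a vec set) pre_digraph"
    and q u v S
  assumes r: "r \<ge> 2" and G: "G = symplectic_graph r" and q: "q = CARD('a)"
    and u: "u \<in> carrier_vec (2 * r)" "u \<noteq> 0\<^sub>v (2 * r)"
    and v: "v \<in> carrier_vec (2 * r)" "v \<noteq> 0\<^sub>v (2 * r)"
    and uv: "sform r u v \<noteq> 0"
    and S: "S = nbhd G (hyperbolic_line u v)"
begin

lemma hyperbolic_line_verts: "hyperbolic_line u v \<subseteq> verts G"
  unfolding G using hyperbolic_line_subset u v uv .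

lemma vecs_on_perp_hyperbolic_line:
  "vecs_on r (perp_points r (hyperbolic_line u v)) = perp r (plane u v) - {0\<^sub>v (2 * r)}"
  by (simp add: vecs_on_perp_points vecs_on_hyperbolic_line[OF u v] perp_Diff_zero)

lemma hyperbolic_cut:
  "hyperbolic_line u v \<union> perp_points r (hyperbolic_line u v) = verts G - S"
  "hyperbolic_line u v \<inter> perp_points r (hyperbolic_line u v) = {}"
  "S \<subseteq> verts G"
proof -
  let ?L = "hyperbolic_line u v"
  show "?L \<union> perp_points r ?L = verts G - S" "S \<subseteq> verts G"
    using nbhd_symplectic_graph[of ?L r] hyperbolic_line_verts perp_points_subset[of r ?L]
    unfolding S G by auto
  show "?L \<inter> perp_points r ?L = {}"
  proof (rule equals0I)
    fix p assume p: "p \<in> ?L \<inter> perp_points r ?L"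
    then have "p \<in> verts (symplectic_graph r)" using hyperbolic_line_verts G by auto
    then obtain x where x: "x \<in> carrier_vec (2 * r)" "x \<noteq> 0\<^sub>v (2 * r)" "p = line x" by (rule vertE)
    then have "x \<in> vecs_on r ?L" "x \<in> vecs_on r (perp_points r ?L)"
      using p by (auto simp: vecs_on_def)
    then show False
      using plane_nondegenerate[OF u(1) v(1) uv]
      by (auto simp: vecs_on_perp_hyperbolic_line vecs_on_hyperbolic_line[OF u v]
        perp_plane[OF u(1) v(1)])
  qed
qed

lemma card_perp_hyperbolic_line:
  "card (perp r (plane u v)) = q ^ (2 * r - 2)"
proof -
  have "q\<^sup>2 * card (perp r (plane u v)) = q\<^sup>2 * q ^ (2 * r - 2)"
    using card_perp[OF lin_closed_plane[OF u(1) v(1)]] card_plane[OF u(1) v(1) uv]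
    by (simp add: q power_double_split(1)[OF r])
  then show ?thesis using card_ge_2_field[where 'a = 'a] by (simp add: q)
qed

lemma card_nbhd_hyperbolic_line:
  "int (card S) = int q ^ (2 * r - 1) + int q ^ (2 * r - 2) - int q - 1"
proof -
  let ?z = "int q ^ (2 * r - 2)"
  have zero: "0\<^sub>v (2 * r) \<in> plane u v" "0\<^sub>v (2 * r) \<in> perp r (plane u v)"
    using lin_closed_plane[OF u(1) v(1)] lin_closed_perp[of "plane u v" r]
    by (auto simp: lin_closed_def)
  have "finite (plane u v)"
    using card_plane[OF u(1) v(1) uv] card_ge_2_field[where 'a = 'a] by (auto intro: card_ge_0_finite)
  then have "card (vecs_on r (hyperbolic_line u v)) + 1 = q\<^sup>2"
    "card (vecs_on r (perp_points r (hyperbolic_line u v))) + 1 = q ^ (2 * r - 2)"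
    using zero card_perp_hyperbolic_line card_plane[OF u(1) v(1) uv] card_ge_2_field[where 'a = 'a]
    by (simp_all add: vecs_on_perp_hyperbolic_line vecs_on_hyperbolic_line[OF u v] q finite_perp)
  \<comment> \<open>Zero belongs to both the plane and its perp but occurs only once in
    \<open>card_cut\<close>, hence the 1 on the right.\<close>
  then have "(q - 1) * card S + q\<^sup>2 + q ^ (2 * r - 2) = q\<^sup>2 * q ^ (2 * r - 2) + 1"
    using card_cut[OF hyperbolic_cut[unfolded G]] by (simp add: q power_double_split(1)[OF r])
  then have "int ((q - 1) * card S + q\<^sup>2 + q ^ (2 * r - 2)) = int (q\<^sup>2 * q ^ (2 * r - 2) + 1)"
    by (rule arg_cong)
  then have "int (q - 1) * int (card S) + (int q)\<^sup>2 + ?z = (int q)\<^sup>2 * ?z + 1"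
    by (simp only: of_nat_add of_nat_mult of_nat_power of_nat_1)
  moreover have "int (q - 1) = int q - 1" "int q - 1 \<noteq> 0"
    using card_ge_2_field[where 'a = 'a] q by auto
  \<comment> \<open>With z = q^(2r-2) this is the factorisation q^2 z - q^2 - z + 1 = (q - 1)(q +
    1)(z - 1).\<close>
  ultimately have "(int q - 1) * int (card S) = (int q - 1) * (int q * ?z + ?z - int q - 1)"
    by (simp add: algebra_simps power2_eq_square)
  then have "int (card S) = int q * ?z + ?z - int q - 1"
    using \<open>int q - 1 \<noteq> 0\<close> by simp
  then show ?thesis by (simp only: power_double_split(2)[OF r, of "int q"])
qed

text \<open>The two sides are the hyperbolic line and its perp. Each point has a neighbour on its
  own side by nondegeneracy there, and this neighbour is a different point because the form is
  alternating.\<close>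

lemma disconnecting_set2_nbhd_hyperbolic_line: "disconnecting_set2 G S"
proof -
  let ?L = "hyperbolic_line u v"
  let ?A = "?L" and ?B = "perp_points r ?L"
  interpret sym_digraph G unfolding G by (rule sym_digraph_symplectic_graph)
  have L: "vecs_on r ?L = plane u v - {0\<^sub>v (2 * r)}" using u v by (rule vecs_on_hyperbolic_line)
  note P = vecs_on_perp_hyperbolic_line
  have vec: "\<exists>x\<in>vecs_on r ?A \<union> vecs_on r ?B. p = line x" if "p \<in> ?A \<union> ?B" for p
  proof -
    have "p \<in> verts (symplectic_graph r)"
      using that hyperbolic_line_verts perp_points_subset G by blast
    then obtain x where "x \<in> carrier_vec (2 * r)" "x \<noteq> 0\<^sub>v (2 * r)" "p = line x" by (rule vertE)
    then show ?thesis using that by (auto simp: vecs_on_def)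
  qed
  show ?thesis
  proof (rule disconnecting_set2I[OF _ hyperbolic_cut(3) hyperbolic_cut(1,2)])
    show "finite (verts G)" unfolding G by (rule finite_verts_symplectic_graph)
    show "?A \<noteq> {}" by (auto simp: hyperbolic_line_def)
    \<comment> \<open>Here r \<ge> 2 matters: for r = 1 the perp of the plane is zero and the second
      side would be empty.\<close>
    have "2 \<le> q ^ (2 * r - 2)"
      using card_ge_2_field[where 'a = 'a] r self_le_power[of q "2 * r - 2"] q by auto
    then have "\<not> perp r (plane u v) \<subseteq> {0\<^sub>v (2 * r)}"
      using card_mono[of "{0\<^sub>v (2 * r)}" "perp r (plane u v)"] card_perp_hyperbolic_line by auto
    then show "?B \<noteq> {}"
      using P by (auto simp: vecs_on_def)
    show "\<not> p \<rightarrow>\<^bsub>G\<^esub> p'" if "p \<in> ?A" "p' \<in> ?B" for p p'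
    proof
      assume "p \<rightarrow>\<^bsub>G\<^esub> p'"
      then have "p' \<rightarrow>\<^bsub>G\<^esub> p" by (rule arcs_ends_symmetric[OF sym_arcs])
      moreover have "p' \<notin> ?A" using that hyperbolic_cut(2) by blast
      ultimately have "p' \<in> S"
        using that(1) adj_in_verts unfolding S nbhd_def by blast
      then show False using that hyperbolic_cut(1) by blast
    qed
    fix p assume "p \<in> ?A \<union> ?B"
    then obtain x where x: "x \<in> vecs_on r ?A \<union> vecs_on r ?B" "p = line x" using vec by blast
    have xc: "x \<in> carrier_vec (2 * r)" "x \<noteq> 0\<^sub>v (2 * r)" using x by (auto simp: vecs_on_def)
    obtain y where y: "y \<in> carrier_vec (2 * r)" "y \<noteq> 0\<^sub>v (2 * r)" "line y \<in> ?A \<union> ?B"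
      "sform r x y \<noteq> 0"
    proof (cases "x \<in> vecs_on r ?A")
      case True
      then have "x \<in> plane u v" using L by simp
      then have "sform r x u \<noteq> 0 \<or> sform r x v \<noteq> 0"
        using plane_nondegenerate[OF u(1) v(1) uv _ xc(2)] sform_swap[OF xc(1) u(1)]
          sform_swap[OF xc(1) v(1)] by auto
      moreover have "line u \<in> ?A" "line v \<in> ?A" by (auto simp: hyperbolic_line_def)
      ultimately show ?thesis using that u v by blast
    next
      case False
      then have "x \<in> perp r (plane u v)" using x P by simp
      then obtain y where y: "y \<in> perp r (plane u v)" "sform r x y \<noteq> 0"
        using perp_plane_nondegenerate[OF u(1) v(1) uv _ xc(2)] by blast
      then have "y \<in> vecs_on r ?B" using P sform_zero_right[OF xc(1)] by auto
      then show ?thesis using that y by (auto simp: vecs_on_def)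
    qed
    have arc: "p \<rightarrow>\<^bsub>G\<^esub> line y"
      unfolding G x(2) using dominates_symplectic_graph_iff[OF xc y(1,2)] y(4) by (rule iffD2)
    have no_loop: "\<not> p \<rightarrow>\<^bsub>G\<^esub> p"
      unfolding G x(2) using dominates_symplectic_graph_iff[OF xc xc] sform_self[OF xc(1)] by blast
    have "line y \<noteq> p"
    proof
      assume eq: "line y = p"
      show False using no_loop arc[unfolded eq] by (rule notE)
    qed
    then have "line y \<noteq> p \<and> p \<rightarrow>\<^bsub>G\<^esub> line y" using arc by (rule conjI)
    then show "\<exists>p'\<in>?A \<union> ?B. p' \<noteq> p \<and> p \<rightarrow>\<^bsub>G\<^esub> p'" using y(3) by (rule bexI)
  qed
qed

end

section \<open>The lower bound\<close>

text \<open>From a b = m z follows m (m + z - a - b) = (a - m)(b - m), and the right side is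
  nonnegative. It is applied with the sizes of U and W as a and b, m = q^2 and z = q^(2r-2).\<close>

lemma sum_le_if_prod_eq:
  fixes a b m z :: nat
  assumes "a * b = m * z" "m \<le> a" "m \<le> b" "m > 0"
  shows "a + b \<le> m + z" and "a + b = m + z \<Longrightarrow> a = m \<or> b = m"
proof -
  have "int m * (int m + int z - int a - int b) = (int a - int m) * (int b - int m)"
    using assms(1) by (simp add: algebra_simps flip: of_nat_mult)
  moreover have "0 \<le> (int a - int m) * (int b - int m)"
    using assms(2,3) by (intro mult_nonneg_nonneg) simp_all
  ultimately have "0 \<le> int m * (int m + int z - int a - int b)"
    and *: "int m + int z - int a - int b = 0 \<Longrightarrow> (int a - int m) * (int b - int m) = 0"
    by auto
  then show "a + b \<le> m + z"
    using \<open>m > 0\<close> by (simp add: zero_le_mult_iff)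
  show "a = m \<or> b = m" if "a + b = m + z" using * that by auto
qed

lemma plane_subset_card:
  fixes U :: "'a::{field, finite} vec set"
  assumes "lin_closed (2 * r) U" "u \<in> U" "v \<in> U" "sform r u v \<noteq> 0"
  shows "CARD('a)\<^sup>2 \<le> card U" and "card U = CARD('a)\<^sup>2 \<Longrightarrow> U = plane u v"
proof -
  have uv: "u \<in> carrier_vec (2 * r)" "v \<in> carrier_vec (2 * r)" and "U \<subseteq> carrier_vec (2 * r)"
    using assms by (auto simp: lin_closed_def)
  have fin: "finite U"
    by (rule finite_subset[OF \<open>U \<subseteq> _\<close> finite_carrier_vec])
  note sub = plane_least[OF assms(1-3)]
  note card = card_plane[OF uv assms(4)]
  show "CARD('a)\<^sup>2 \<le> card U" using card_mono[OF fin sub] card by simp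
  show "U = plane u v" if "card U = CARD('a)\<^sup>2"
    using card_subset_eq[OF fin sub] card that by simp
qed

lemma arc_in_symplectic_graphE:
  assumes "A \<subseteq> verts (symplectic_graph r)" "\<exists>a\<in>A. \<exists>a'\<in>A. a \<rightarrow>\<^bsub>symplectic_graph r\<^esub> a'"
  obtains u v where "u \<in> vecs_on r A" "v \<in> vecs_on r A" "sform r u v \<noteq> 0"
proof -
  obtain a a' where a: "a \<in> A" "a' \<in> A" "a \<rightarrow>\<^bsub>symplectic_graph r\<^esub> a'" using assms by blast
  obtain u where u: "u \<in> vecs_on r A" "a = line u"
    using a(1) line_image_vecs_on[OF assms(1)] by blast
  obtain v where v: "v \<in> vecs_on r A" "a' = line v"
    using a(2) line_image_vecs_on[OF assms(1)] by blast
  have "sform r u v \<noteq> 0"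
    using a(3) u v by (simp add: vecs_on_def dominates_symplectic_graph_iff)
  then show ?thesis using that u v by blast
qed

text \<open>A set of vertices is determined by its vectors, so A is the hyperbolic line and B its
  perp. A and B are free in the statement because either side of a cut may turn out to be the
  plane.\<close>

lemma hyperbolic_line_from_cut:
  assumes A: "A \<subseteq> verts (symplectic_graph r)" and B: "B \<subseteq> verts (symplectic_graph r)"
    and S: "S \<subseteq> verts (symplectic_graph r)" "A \<union> B = verts (symplectic_graph r) - S"
    and vA: "vecs_on r A = plane u v - {0\<^sub>v (2 * r)}"
    and vB: "vecs_on r B = perp r (plane u v) - {0\<^sub>v (2 * r)}"
    and uv: "u \<in> vecs_on r A" "v \<in> vecs_on r A" "sform r u v \<noteq> 0"
  shows "S = nbhd (symplectic_graph r) (hyperbolic_line u v)"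
proof -
  have u: "u \<in> carrier_vec (2 * r)" "u \<noteq> 0\<^sub>v (2 * r)" and v: "v \<in> carrier_vec (2 * r)" "v \<noteq> 0\<^sub>v (2 * r)"
    using uv by (auto simp: vecs_on_def)
  have "A = hyperbolic_line u v"
    using line_image_vecs_on[OF A] line_image_vecs_on[OF hyperbolic_line_subset[OF u v uv(3)]] vA
      vecs_on_hyperbolic_line[OF u v] by simp
  moreover have "perp_points r A = B"
    unfolding perp_points_def vA perp_Diff_zero vB[symmetric] by (rule line_image_vecs_on[OF B])
  ultimately show ?thesis using nbhd_symplectic_graph[OF A] S by blast
qed

lemma disconnecting_set2_symplectic_graph:
  fixes S :: "'a::{field, finite} vec set set"
  assumes r: "r \<ge> 2" and q: "q = CARD('a)" and S: "disconnecting_set2 (symplectic_graph r) S"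
  shows "int q ^ (2 * r - 1) + int q ^ (2 * r - 2) - int q - 1 \<le> int (card S)"
    and "int (card S) = int q ^ (2 * r - 1) + int q ^ (2 * r - 2) - int q - 1 \<Longrightarrow>
      \<exists>u v. u \<in> carrier_vec (2 * r) \<and> u \<noteq> 0\<^sub>v (2 * r) \<and>
        v \<in> carrier_vec (2 * r) \<and> v \<noteq> 0\<^sub>v (2 * r) \<and> sform r u v \<noteq> 0 \<and>
        S = nbhd (symplectic_graph r) (hyperbolic_line u v)"
proof -
  let ?G = "symplectic_graph r :: ('a vec set, 'a vec set \<times> 'a vec set) pre_digraph"
  let ?z = "q ^ (2 * r - 2)" and ?o = "0\<^sub>v (2 * r) :: 'a vec"
  interpret sym_digraph ?G by (rule sym_digraph_symplectic_graph)
  have SG: "S \<subseteq> verts ?G" using S by (simp add: disconnecting_set2_def disconnecting_set_def)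
  obtain A B where AB: "A \<union> B = verts ?G - S" "A \<inter> B = {}"
    and no_arc: "\<forall>a\<in>A. \<forall>b\<in>B. \<not> a \<rightarrow>\<^bsub>?G\<^esub> b"
    and arc_A: "\<exists>a\<in>A. \<exists>a'\<in>A. a \<rightarrow>\<^bsub>?G\<^esub> a'" and arc_B: "\<exists>b\<in>B. \<exists>b'\<in>B. b \<rightarrow>\<^bsub>?G\<^esub> b'"
    using disconnecting_set2_split[OF S] .
  have AG: "A \<subseteq> verts ?G" and BG: "B \<subseteq> verts ?G" using AB(1) by blast+
  define W where "W = perp r (vecs_on r A)"
  define U where "U = perp r W"
  have W: "lin_closed (2 * r) W"
    unfolding W_def by (rule lin_closed_perp[OF vecs_on_subset_carrier])
  then have U: "lin_closed (2 * r) U"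
    unfolding U_def by (intro lin_closed_perp) (simp add: lin_closed_def)
  have fin: "finite U" "finite W" unfolding U_def W_def by (rule finite_perp)+
  have zero: "?o \<in> U" "?o \<in> W" using U W by (simp_all add: lin_closed_def)
  have A_sub: "vecs_on r A \<subseteq> U - {?o}"
    using perp_perp_subset[OF vecs_on_subset_carrier, of r A]
    unfolding U_def W_def by (auto simp: vecs_on_def)
  have B_sub: "vecs_on r B \<subseteq> W - {?o}"
  proof
    fix y assume y: "y \<in> vecs_on r B"
    have "sform r x y = 0" if x: "x \<in> vecs_on r A" for x
    proof -
      have "\<not> line x \<rightarrow>\<^bsub>?G\<^esub> line y" using no_arc x y by (simp add: vecs_on_def)
      then show ?thesis using x y by (simp add: vecs_on_def dominates_symplectic_graph_iff)
    qed
    then show "y \<in> W - {?o}" using y by (simp add: W_def perp_def vecs_on_def)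
  qed
  obtain u v where uv: "u \<in> vecs_on r A" "v \<in> vecs_on r A" "sform r u v \<noteq> 0"
    using arc_in_symplectic_graphE[OF AG arc_A] .
  obtain u' v' where uv': "u' \<in> vecs_on r B" "v' \<in> vecs_on r B" "sform r u' v' \<noteq> 0"
    using arc_in_symplectic_graphE[OF BG arc_B] .
  have "u \<in> U" "v \<in> U" "u' \<in> W" "v' \<in> W" using uv uv' A_sub B_sub by blast+
  note U_plane = plane_subset_card[OF U this(1,2) uv(3)]
    and W_plane = plane_subset_card[OF W this(3,4) uv'(3)]
  have prod: "card U * card W = q\<^sup>2 * ?z"
    using card_perp[OF W] power_double_split(1)[OF r, of q] by (simp add: U_def q mult.commute)
  have q2: "q\<^sup>2 > 0" using card_ge_2_field[where 'a = 'a] q by simp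
  have le: "card U + card W \<le> q\<^sup>2 + ?z"
    and eq: "card U + card W = q\<^sup>2 + ?z \<Longrightarrow> card U = q\<^sup>2 \<or> card W = q\<^sup>2"
    using sum_le_if_prod_eq[OF prod _ _ q2] U_plane(1) W_plane(1) q by simp_all
  have card_U: "card (U - {?o}) + 1 = card U" and card_W: "card (W - {?o}) + 1 = card W"
    using fin zero card_Suc_Diff1 by fastforce+
  have vA: "card (vecs_on r A) + 1 \<le> card U" and vB: "card (vecs_on r B) + 1 \<le> card W"
    using card_mono[OF _ A_sub] card_mono[OF _ B_sub] fin card_U card_W by simp_all
  have cut: "(q - 1) * card S + card (vecs_on r A) + card (vecs_on r B) + 1 = q\<^sup>2 * ?z"
    using card_cut[OF AB SG] by (simp only: q power_double_split(1)[OF r])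
  have "int (q - 1) = int q - 1" and q1: "int q - 1 > 0"
    using card_ge_2_field[where 'a = 'a] q by auto
  then have cut': "(int q - 1) * int (card S) + int (card (vecs_on r A)) +
      int (card (vecs_on r B)) + 1 = (int q)\<^sup>2 * int ?z"
    using arg_cong[OF cut, of int] by (simp only: of_nat_add of_nat_mult of_nat_power of_nat_1)
  \<comment> \<open>Multiplied by q - 1, this factored form is the number of vectors left for S when
    A and B fill U and W and |U| + |W| is as large as possible.\<close>
  have bound: "int q ^ (2 * r - 1) + int q ^ (2 * r - 2) - int q - 1 = (int q + 1) * (int ?z - 1)"
    unfolding power_double_split(2)[OF r, of "int q"] by (simp add: algebra_simps)
  have prod_bound: "(int q - 1) * ((int q + 1) * (int ?z - 1)) =
      (int q)\<^sup>2 * int ?z - (int q)\<^sup>2 - int ?z + 1"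
    by (simp add: algebra_simps power2_eq_square)
  have sum_le: "int (card (vecs_on r A)) + int (card (vecs_on r B)) + 2 \<le> (int q)\<^sup>2 + int ?z"
    using vA vB le unfolding of_nat_power[symmetric] by linarith
  have "(int q - 1) * ((int q + 1) * (int ?z - 1)) \<le> (int q - 1) * int (card S)"
    using prod_bound cut' sum_le by linarith
  then show "int q ^ (2 * r - 1) + int q ^ (2 * r - 2) - int q - 1 \<le> int (card S)"
    unfolding bound using q1 by (simp only: mult_le_cancel_left_pos)
  assume "int (card S) = int q ^ (2 * r - 1) + int q ^ (2 * r - 2) - int q - 1"
  then have card_S: "int (card S) = (int q + 1) * (int ?z - 1)" unfolding bound .
  have "int (card (vecs_on r A)) + int (card (vecs_on r B)) + 2 = (int q)\<^sup>2 + int ?z"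
    using prod_bound cut' unfolding card_S by linarith
  then have "card (vecs_on r A) + card (vecs_on r B) + 2 = q\<^sup>2 + ?z"
    unfolding of_nat_power[symmetric] by linarith
  \<comment> \<open>The estimates \<open>vA\<close>, \<open>vB\<close> and \<open>le\<close> now add
    up to an equality, so each of them is tight.\<close>
  then have card_UW: "card U + card W = q\<^sup>2 + ?z"
    and "card (vecs_on r A) + 1 = card U" "card (vecs_on r B) + 1 = card W"
    using vA vB le by linarith+
  then have "card (vecs_on r A) = card (U - {?o})" "card (vecs_on r B) = card (W - {?o})"
    using card_U card_W by linarith+
  then have vecs: "vecs_on r A = U - {?o}" "vecs_on r B = W - {?o}"
    using card_subset_eq[OF _ A_sub] card_subset_eq[OF _ B_sub] fin by simp_all
  \<comment> \<open>Since A fills U, the subspaces U and W are perps of each other, and the two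
    cases below differ only by exchanging the sides.\<close>
  have W_eq: "W = perp r U"
    using perp_Diff_zero[of r U] unfolding W_def vecs(1) .
  from eq[OF card_UW] show "\<exists>u v. u \<in> carrier_vec (2 * r) \<and> u \<noteq> ?o \<and>
      v \<in> carrier_vec (2 * r) \<and> v \<noteq> ?o \<and> sform r u v \<noteq> 0 \<and> S = nbhd ?G (hyperbolic_line u v)"
  proof
    assume "card U = q\<^sup>2"
    then have "U = plane u v" using U_plane(2) q by simp
    then have "S = nbhd ?G (hyperbolic_line u v)"
      using hyperbolic_line_from_cut[OF AG BG SG AB(1) _ _ uv] vecs W_eq by simp
    then show ?thesis using uv by (auto simp: vecs_on_def)
  next
    assume "card W = q\<^sup>2"
    then have "W = plane u' v'" using W_plane(2) q by simp
    moreover have "B \<union> A = verts ?G - S" using AB(1) by blast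
    ultimately have "S = nbhd ?G (hyperbolic_line u' v')"
      using hyperbolic_line_from_cut[OF BG AG SG _ _ _ uv'] vecs U_def by simp
    then show ?thesis using uv' by (auto simp: vecs_on_def)
  qed
qed

text \<open>The finite field \<open>'a\<close> stands for the prime power q, and the equations live
  in the integers so that the subtractions are genuine.\<close>

theorem proposition5p2:
  fixes q r :: nat
    and G :: "('a::{field, finite} vec set, 'a vec set \<times> 'a vec set) pre_digraph"
  assumes "q = CARD('a)"
    and "r \<ge> 2"
    and "G = symplectic_graph r"
  shows "int (kappa2 G) = int q ^ (2 * r - 1) + int q ^ (2 * r - 2) - int q - 1 \<and>
    (\<forall>S. disconnecting_set2 G S \<and>
           int (card S) = int q ^ (2 * r - 1) + int q ^ (2 * r - 2) - int q - 1 \<longleftrightarrow>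
         (\<exists>u v. u \<in> carrier_vec (2 * r) \<and> u \<noteq> 0\<^sub>v (2 * r) \<and>
                v \<in> carrier_vec (2 * r) \<and> v \<noteq> 0\<^sub>v (2 * r) \<and>
                line u \<rightarrow>\<^bsub>G\<^esub> line v \<and> S = nbhd G (hyperbolic_line u v)))"
proof -
  define k where "k = int q ^ (2 * r - 1) + int q ^ (2 * r - 2) - int q - 1"
  define hyp where "hyp S \<longleftrightarrow> (\<exists>u v. u \<in> carrier_vec (2 * r) \<and> u \<noteq> 0\<^sub>v (2 * r) \<and>
                v \<in> carrier_vec (2 * r) \<and> v \<noteq> 0\<^sub>v (2 * r) \<and>
                line u \<rightarrow>\<^bsub>G\<^esub> line v \<and> S = nbhd G (hyperbolic_line u v))" for S
  have ge: "k \<le> int (card S)" if "disconnecting_set2 G S" for S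
    using disconnecting_set2_symplectic_graph(1)[OF assms(2,1)] that assms(3) by (simp add: k_def)
  have hypD: "disconnecting_set2 G S" "int (card S) = k" if hyp: "hyp S" for S
  proof -
    obtain u v where u: "u \<in> carrier_vec (2 * r)" "u \<noteq> 0\<^sub>v (2 * r)"
      and v: "v \<in> carrier_vec (2 * r)" "v \<noteq> 0\<^sub>v (2 * r)"
      and arc: "line u \<rightarrow>\<^bsub>G\<^esub> line v" and S: "S = nbhd G (hyperbolic_line u v)"
      using hyp unfolding hyp_def by blast
    have uv: "sform r u v \<noteq> 0"
      using arc dominates_symplectic_graph_iff[OF u v] assms(3) by simp
    show "disconnecting_set2 G S"
      by (rule disconnecting_set2_nbhd_hyperbolic_line[OF assms(2,3,1) u v uv S])
    show "int (card S) = k"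
      unfolding k_def by (rule card_nbhd_hyperbolic_line[OF assms(2,3,1) u v uv S])
  qed
  have hypI: "hyp S" if cut: "disconnecting_set2 G S" "int (card S) = k" for S
  proof -
    obtain u v where u: "u \<in> carrier_vec (2 * r)" "u \<noteq> 0\<^sub>v (2 * r)"
      and v: "v \<in> carrier_vec (2 * r)" "v \<noteq> 0\<^sub>v (2 * r)"
      and uv: "sform r u v \<noteq> 0" and S: "S = nbhd G (hyperbolic_line u v)"
      using disconnecting_set2_symplectic_graph(2)[OF assms(2,1)] cut
      unfolding assms(3) k_def by blast
    have "line u \<rightarrow>\<^bsub>G\<^esub> line v"
      using uv dominates_symplectic_graph_iff[OF u v] assms(3) by simp
    then show ?thesis unfolding hyp_def using u v S by blast
  qed
  \<comment> \<open>The infimum in \<open>kappa2\<close> is a minimum only if some admissible set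
    exists. A unit vector and a vector that pairs nontrivially with it provide a hyperbolic line; r
    \<ge> 2 makes coordinate 0 available.\<close>
  obtain S where S: "hyp S"
  proof -
    let ?u = "unit_vec (2 * r) 0 :: 'a vec"
    have u: "?u \<in> carrier_vec (2 * r)" "?u \<noteq> 0\<^sub>v (2 * r)"
      using assms(2) by (auto simp: vec_eq_iff intro!: exI[of _ 0])
    then obtain v where v: "v \<in> carrier_vec (2 * r)" "sform r ?u v \<noteq> 0"
      using sform_nondegenerate by blast
    then have v0: "v \<noteq> 0\<^sub>v (2 * r)" using sform_zero_right[OF u(1)] by auto
    have "line ?u \<rightarrow>\<^bsub>G\<^esub> line v"
      using v(2) dominates_symplectic_graph_iff[OF u v(1) v0] assms(3) by simp
    then have "hyp (nbhd G (hyperbolic_line ?u v))"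
      unfolding hyp_def using u v(1) v0 by blast
    then show ?thesis using that by blast
  qed
  have "kappa2 G = card S"
    unfolding kappa2_def
  proof (rule cInf_eq_minimum)
    show "card S \<in> card ` {S. disconnecting_set2 G S}" using hypD(1)[OF S] by blast
    fix n assume "n \<in> card ` {S. disconnecting_set2 G S}"
    then obtain T where "disconnecting_set2 G T" "n = card T" by blast
    then show "card S \<le> n" using ge[of T] hypD(2)[OF S] by simp
  qed
  then have "int (kappa2 G) = k" using hypD(2)[OF S] by simp
  moreover have "disconnecting_set2 G S \<and> int (card S) = k \<longleftrightarrow> hyp S" for S
    using hypD hypI by blast
  ultimately show ?thesis unfolding k_def hyp_def by blast
qed

end
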